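(* For every $n$ there exists a directed graph $G$ with $\Theta(n)$ vertices such that every $1$-faulty-degree-tolerant connectivity preserver $H\subseteq G$ of $G$ has $\Omega(n^2)$ edges.
   Context: A subgraph $H$ of a directed graph $G$ ($V(H)=V(G)$, $E(H)\subseteq E(G)$) is a $k$-faulty-degree-tolerant connectivity preserver of $G$ if for every pair of vertices $u,v$ and every edge set $F\subseteq E(G)$ such that $|F\cap(\delta^+(x)\cup\delta^-(x))|\le k$ for every vertex $x$ (where $\delta^+(x),\delta^-(x)$ are the out- and in-edges of $x$), $u,v$ are strongly connected in $G-F$ if and only if they are strongly connected in $H-F$. *)

theory Defs
  imports Complex_Main "Graph_Theory.Digraph_Component"
begin

definition del_arcs :: "('a, 'b) pre_digraph \<Rightarrow> 'b set \<Rightarrow> ('a, 'b) pre_digraph" where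
  "del_arcs G F = G\<lparr>arcs := arcs G - F\<rparr>"

definition strongly_connected_pair :: "('a, 'b) pre_digraph \<Rightarrow> 'a \<Rightarrow> 'a \<Rightarrow> bool" where
  "strongly_connected_pair G u v \<longleftrightarrow> u \<rightarrow>\<^sup>*\<^bsub>G\<^esub> v \<and> v \<rightarrow>\<^sup>*\<^bsub>G\<^esub> u"

(* The finiteness conjunct is automatic for finite digraphs; it only prevents
   card from reporting 0 on an infinite set. *)
definition faulty_degree_at_most :: "('a, 'b) pre_digraph \<Rightarrow> nat \<Rightarrow> 'b set \<Rightarrow> bool" where
  "faulty_degree_at_most G k F \<longleftrightarrow> F \<subseteq> arcs G \<and>
     (\<forall>x\<in>verts G. finite (F \<inter> (out_arcs G x \<union> in_arcs G x)) \<and>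
                  card (F \<inter> (out_arcs G x \<union> in_arcs G x)) \<le> k)"

definition fdt_connectivity_preserver ::
    "nat \<Rightarrow> ('a, 'b) pre_digraph \<Rightarrow> ('a, 'b) pre_digraph \<Rightarrow> bool" where
  "fdt_connectivity_preserver k H G \<longleftrightarrow> spanning H G \<and>
     (\<forall>u\<in>verts G. \<forall>v\<in>verts G. \<forall>F. faulty_degree_at_most G k F \<longrightarrow>
        (strongly_connected_pair (del_arcs G F) u v \<longleftrightarrow>
         strongly_connected_pair (del_arcs H F) u v))"

end

theory Submission
  imports Defs
begin

text \<open>
  Take vertices \<open>a\<^sub>i\<close>, \<open>b\<^sub>i\<close>, \<open>c\<^sub>i\<close> for \<open>i < n\<close>, all arcs \<open>a\<^sub>i \<rightarrow> b\<^sub>j\<close>, all arcs \<open>c\<^sub>j \<rightarrow> a\<^sub>i\<close> and the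
  matching \<open>b\<^sub>j \<rightarrow> c\<^sub>j\<close>. Deleting every matching arc except \<open>b\<^sub>j \<rightarrow> c\<^sub>j\<close> costs at most one fault per
  vertex and turns all other \<open>b\<^sub>k\<close> into dead ends. Then \<open>a\<^sub>i\<close> and \<open>b\<^sub>j\<close> are still strongly connected,
  but \<open>a\<^sub>i\<close> reaches \<open>b\<^sub>j\<close> only by the arc \<open>a\<^sub>i \<rightarrow> b\<^sub>j\<close>; so a preserver contains all these \<open>n\<^sup>2\<close> arcs.
\<close>

text \<open>Induction along the walk. Used to refute reachability: a set closed under out-arcs that
  contains \<open>u\<close> but not \<open>v\<close> separates them.\<close>

lemma reachable_in_closed_set:
  assumes "u \<rightarrow>\<^sup>*\<^bsub>G\<^esub> v" and "u \<in> S"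
    and "\<And>e. e \<in> arcs G \<Longrightarrow> tail G e \<in> S \<Longrightarrow> head G e \<in> S"
  shows "v \<in> S"
  using assms(1,2) unfolding reachable_def
  by (induction rule: rtrancl_on.induct)
    (auto simp: arcs_ends_def arc_to_ends_def assms(3))

text \<open>The vertices \<open>a\<^sub>i\<close>, \<open>b\<^sub>i\<close>, \<open>c\<^sub>i\<close> are encoded as \<open>i\<close>, \<open>n + i\<close>, \<open>2 * n + i\<close>.\<close>

definition tripartite_digraph :: "nat \<Rightarrow> (nat, nat \<times> nat) pre_digraph" where
  "tripartite_digraph n =
    \<lparr>verts = {..<3 * n},
     arcs = {(i, n + j) | i j. i < n \<and> j < n} \<union> {(n + j, 2 * n + j) | j. j < n}
       \<union> {(2 * n + j, i) | i j. i < n \<and> j < n},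
     tail = fst, head = snd\<rparr>"

definition matching_faults :: "nat \<Rightarrow> nat \<Rightarrow> (nat \<times> nat) set" where
  "matching_faults n j = {(n + k, 2 * n + k) | k. k < n \<and> k \<noteq> j}"

lemma digraph_tripartite_digraph: "digraph (tripartite_digraph n)"
proof
  have "arcs (tripartite_digraph n) \<subseteq> {..<3 * n} \<times> {..<3 * n}"
    by (auto simp: tripartite_digraph_def)
  then show "finite (arcs (tripartite_digraph n))"
    by (rule finite_subset) simp
qed (auto simp: tripartite_digraph_def arc_to_ends_def)

lemma faulty_degree_matching_faults:
  "faulty_degree_at_most (tripartite_digraph n) 1 (matching_faults n j)"
proof -
  let ?G = "tripartite_digraph n"
  have "finite (matching_faults n j \<inter> (out_arcs ?G x \<union> in_arcs ?G x)) \<and>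
      card (matching_faults n j \<inter> (out_arcs ?G x \<union> in_arcs ?G x)) \<le> 1" for x
  proof -
    \<comment> \<open>\<open>?k\<close> is the index of the only matching arc that can meet
      \<open>x\<close>. For \<open>x < n\<close> truncated subtraction gives 0, which is harmless
      since no matching arc meets \<open>x\<close>.\<close>
    let ?k = "if x < 2 * n then x - n else x - 2 * n"
    have sub: "matching_faults n j \<inter> (out_arcs ?G x \<union> in_arcs ?G x) \<subseteq> {(n + ?k, 2 * n + ?k)}"
      by (auto simp: matching_faults_def tripartite_digraph_def)
    show ?thesis
      using finite_subset[OF sub] card_mono[OF _ sub] by simp
  qed
  moreover have "matching_faults n j \<subseteq> arcs ?G"
    by (auto simp: matching_faults_def tripartite_digraph_def)
  ultimately show ?thesis
    by (simp add: faulty_degree_at_most_def)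
qed

text \<open>The directed triangle \<open>i\<close>, \<open>n + j\<close>, \<open>2 * n + j\<close>
  avoids all faults.\<close>

lemma strongly_connected_after_matching_faults:
  assumes "i < n" and "j < n"
  shows "strongly_connected_pair (del_arcs (tripartite_digraph n) (matching_faults n j)) i (n + j)"
proof -
  let ?D = "del_arcs (tripartite_digraph n) (matching_faults n j)"
  interpret wf_digraph ?D
    by unfold_locales (auto simp: del_arcs_def tripartite_digraph_def)
  have arc: "u \<rightarrow>\<^sup>*\<^bsub>?D\<^esub> v" if "(u, v) \<in> arcs ?D" for u v
  proof -
    have "tail ?D (u, v) = u" "head ?D (u, v) = v"
      by (simp_all add: del_arcs_def tripartite_digraph_def)
    then show ?thesis
      using in_arcs_imp_in_arcs_ends[OF that] by simp
  qed
  have "(i, n + j) \<in> arcs ?D" "(n + j, 2 * n + j) \<in> arcs ?D" "(2 * n + j, i) \<in> arcs ?D"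
    using assms by (auto simp: del_arcs_def tripartite_digraph_def matching_faults_def)
  note this[THEN arc]
  then show ?thesis
    unfolding strongly_connected_pair_def using reachable_trans[of "n + j" "2 * n + j" i] by simp
qed

lemma preserver_contains_bipartite_arc:
  assumes H: "fdt_connectivity_preserver 1 H (tripartite_digraph n)" and ij: "i < n" "j < n"
  shows "(i, n + j) \<in> arcs H"
proof (rule ccontr)
  assume missing: "(i, n + j) \<notin> arcs H"
  let ?G = "tripartite_digraph n" and ?F = "matching_faults n j"
  have sub: "arcs H \<subseteq> arcs ?G" "compatible ?G H"
    using H by (auto simp: fdt_connectivity_preserver_def spanning_def)
  then have ends: "tail H = fst" "head H = snd"
    by (auto simp: compatible_def tripartite_digraph_def)
  have "i \<in> verts ?G" "n + j \<in> verts ?G"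
    using ij by (auto simp: tripartite_digraph_def)
  then have "strongly_connected_pair (del_arcs H ?F) i (n + j)"
    using H faulty_degree_matching_faults strongly_connected_after_matching_faults[OF ij]
    unfolding fdt_connectivity_preserver_def by blast
  then have "i \<rightarrow>\<^sup>*\<^bsub>del_arcs H ?F\<^esub> (n + j)"
    by (simp add: strongly_connected_pair_def)
  \<comment> \<open>This set omits \<open>n + j\<close>, so closure gives the contradiction: without
    the missing arc, \<open>i\<close> leads only to the other \<open>n + k\<close>, whose sole
    out-arcs are faulty.\<close>
  then have "n + j \<in> insert i {n + k | k. k < n \<and> k \<noteq> j}"
  proof (rule reachable_in_closed_set)
    fix e
    assume e: "e \<in> arcs (del_arcs H ?F)"
      and t: "tail (del_arcs H ?F) e \<in> insert i {n + k | k. k < n \<and> k \<noteq> j}"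
    have e': "e \<in> arcs ?G" "e \<notin> ?F" "e \<noteq> (i, n + j)"
      using e sub missing by (auto simp: del_arcs_def)
    from this(1) consider
        (ab) l k where "e = (l, n + k)" "l < n" "k < n"
      | (bc) k where "e = (n + k, 2 * n + k)" "k < n"
      | (ca) l k where "e = (2 * n + k, l)" "k < n" "l < n"
      by (auto simp: tripartite_digraph_def)
    then show "head (del_arcs H ?F) e \<in> insert i {n + k | k. k < n \<and> k \<noteq> j}"
      by cases (use e' t ij in \<open>auto simp: del_arcs_def ends matching_faults_def\<close>)
  qed simp
  then show False
    using ij by auto
qed

lemma card_arcs_preserver_ge:
  assumes H: "fdt_connectivity_preserver 1 H (tripartite_digraph n)"
  shows "n\<^sup>2 \<le> card (arcs H)"
proof -
  interpret G: digraph "tripartite_digraph n"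
    by (rule digraph_tripartite_digraph)
  have "arcs H \<subseteq> arcs (tripartite_digraph n)"
    using H by (auto simp: fdt_connectivity_preserver_def spanning_def)
  then have fin: "finite (arcs H)"
    by (rule finite_subset) simp
  have "{..<n} \<times> {n..<n + n} \<subseteq> arcs H"
  proof (rule subrelI)
    fix i b
    assume "(i, b) \<in> {..<n} \<times> {n..<n + n}"
    then show "(i, b) \<in> arcs H"
      using preserver_contains_bipartite_arc[OF H, of i "b - n"] by auto
  qed
  from card_mono[OF fin this] show ?thesis
    by (simp add: power2_eq_square)
qed

theorem theoremB2:
  shows "\<exists>c1 c2 c3 :: real. c1 > 0 \<and> c2 > 0 \<and> c3 > 0 \<and>
    (\<forall>n :: nat. \<exists>G :: (nat, nat \<times> nat) pre_digraph.
       digraph G \<and>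
       c1 * real n \<le> real (card (verts G)) \<and> real (card (verts G)) \<le> c2 * real n \<and>
       (\<forall>H. fdt_connectivity_preserver 1 H G \<longrightarrow>
          c3 * (real n)\<^sup>2 \<le> real (card (arcs H))))"
proof (intro exI conjI allI impI)
  fix n :: nat
  show "digraph (tripartite_digraph n)"
    by (rule digraph_tripartite_digraph)
  show "3 * real n \<le> real (card (verts (tripartite_digraph n)))"
    "real (card (verts (tripartite_digraph n))) \<le> 3 * real n"
    by (simp_all add: tripartite_digraph_def)
  show "1 * (real n)\<^sup>2 \<le> real (card (arcs H))"
    if "fdt_connectivity_preserver 1 H (tripartite_digraph n)" for H
    using of_nat_mono[OF card_arcs_preserver_ge[OF that], where 'a = real] by simp
qed simp_all

end
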